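(* Let $1<\alpha<2$ and $1<\beta<2$, and consider the two-person bimatrix game $(\mathbf U,\mathbf V)$ with $$\mathbf U=\begin{pmatrix}2-\alpha & -(\alpha-1) & -\alpha\\ 1 & 0 & -1\\ \beta & \beta-1 & -(2-\beta)\end{pmatrix},\qquad \mathbf V=\begin{pmatrix}2-\alpha & 1 & \beta\\ -(\alpha-1) & 0 & \beta-1\\ -\alpha & -1 & -(2-\beta)\end{pmatrix},$$ where rows are Player 1's pure strategies and columns are Player 2's pure strategies, in the order Preempt, Status Quo, Deter. Then: (i) the matrix game $\mathbf U-\mathbf V$ has a saddle point at entry $(3,3)$ with value $\delta=0$, so $\mathbf p^*=\mathbf q^*=(0,0,1)^{T}$ are optimal threat strategies, and the corresponding disagreement point is $(-(2-\beta),-(2-\beta))$; (ii) $\sigma=\max_{i,j}(u_{ij}+v_{ij})=2(2-\alpha)$; (iii) the TU solution of the game is $$\boldsymbol\varphi^*=(2-\alpha,\,2-\alpha),$$ which equals the payoff pair $(u_{11},v_{11})$ of (Preempt, Preempt), so no side payment is required. Consequently, for $B>0$, $c=\alpha B$, $C=B$ and $b=\beta B$, the TU solution of the game with bimatrix $(B\mathbf U,B\mathbf V)$ is $(2B-c,\,2B-c)$.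
   Context: For a bimatrix game $(\mathbf A,\mathbf B)$ (Player 1 chooses a row and receives payoff $a_{ij}$, Player 2 chooses a column and receives payoff $b_{ij}$), the transferable utility (TU) cooperative solution is defined as follows. Let $\sigma=\max_{i,j}(a_{ij}+b_{ij})$. Let $\delta=\mathrm{Val}(\mathbf A-\mathbf B)$ be the minimax value of the two-person zero-sum matrix game with payoff matrix $\mathbf A-\mathbf B$ (the row player maximizes). Optimal mixed strategies $(\mathbf p^*,\mathbf q^* )$ of this zero-sum game are called optimal threat strategies, and $(D_1,D_2)=(\mathbf p^{*T}\mathbf A\mathbf q^*,\mathbf p^{*T}\mathbf B\mathbf q^* )$ is the corresponding disagreement point. The TU solution is $$\boldsymbol\varphi^*=\Big(\frac{\sigma+\delta}{2},\frac{\sigma-\delta}{2}\Big).$$ If a pure strategy pair $(i,j)$ attaining the maximum $\sigma$ has payoff pair $(a_{ij},b_{ij})=\boldsymbol\varphi^*$, no side payment is required. A saddle point of a matrix is an entry that is simultaneously a minimum of its row and a maximum of its column. *)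

theory Defs
  imports "HOL-Analysis.Analysis"
begin

text \<open>
  A matrix with rows indexed by \<open>'m\<close> and columns indexed by \<open>'n\<close> is an element of
  \<open>real ^ 'n ^ 'm\<close>, so that \<open>M $ i $ j\<close> is the entry in row \<open>i\<close> and column \<open>j\<close>.
\<close>

definition mixed_strategies :: "(real ^ 'n) set" where
  "mixed_strategies = {p. (\<forall>i. 0 \<le> p $ i) \<and> (\<Sum>i\<in>UNIV. p $ i) = 1}"

definition expected_payoff :: "real ^ 'n ^ 'm \<Rightarrow> real ^ 'm \<Rightarrow> real ^ 'n \<Rightarrow> real" where
  "expected_payoff M p q = p \<bullet> (M *v q)"

definition saddle_point :: "real ^ 'n ^ 'm \<Rightarrow> 'm \<Rightarrow> 'n \<Rightarrow> bool" where
  "saddle_point M i j \<longleftrightarrow> (\<forall>j'. M $ i $ j \<le> M $ i $ j') \<and> (\<forall>i'. M $ i' $ j \<le> M $ i $ j)"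

text \<open>
  The expected payoff is bounded on the nonempty compact sets of mixed strategies, so all
  suprema and infima below are those of nonempty bounded sets of reals.
\<close>

definition maxmin_value :: "real ^ 'n ^ 'm \<Rightarrow> real" where
  "maxmin_value M = (SUP p\<in>mixed_strategies. INF q\<in>mixed_strategies. expected_payoff M p q)"

definition minmax_value :: "real ^ 'n ^ 'm \<Rightarrow> real" where
  "minmax_value M = (INF q\<in>mixed_strategies. SUP p\<in>mixed_strategies. expected_payoff M p q)"

definition has_game_value :: "real ^ 'n ^ 'm \<Rightarrow> real \<Rightarrow> bool" where
  "has_game_value M v \<longleftrightarrow> maxmin_value M = v \<and> minmax_value M = v"

definition Val :: "real ^ 'n ^ 'm \<Rightarrow> real" where
  "Val M = (THE v. has_game_value M v)"

definition optimal_row_strategy :: "real ^ 'n ^ 'm \<Rightarrow> real ^ 'm \<Rightarrow> bool" where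
  "optimal_row_strategy M p \<longleftrightarrow>
     p \<in> mixed_strategies \<and> (\<forall>q\<in>mixed_strategies. Val M \<le> expected_payoff M p q)"

definition optimal_column_strategy :: "real ^ 'n ^ 'm \<Rightarrow> real ^ 'n \<Rightarrow> bool" where
  "optimal_column_strategy M q \<longleftrightarrow>
     q \<in> mixed_strategies \<and> (\<forall>p\<in>mixed_strategies. expected_payoff M p q \<le> Val M)"

definition optimal_threat_strategies ::
  "real ^ 'n ^ 'm \<Rightarrow> real ^ 'n ^ 'm \<Rightarrow> real ^ 'm \<Rightarrow> real ^ 'n \<Rightarrow> bool" where
  "optimal_threat_strategies A B p q \<longleftrightarrow>
     optimal_row_strategy (A - B) p \<and> optimal_column_strategy (A - B) q"

definition disagreement_point ::
  "real ^ 'n ^ 'm \<Rightarrow> real ^ 'n ^ 'm \<Rightarrow> real ^ 'm \<Rightarrow> real ^ 'n \<Rightarrow> real \<times> real" where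
  "disagreement_point A B p q = (expected_payoff A p q, expected_payoff B p q)"

definition TU_sigma :: "real ^ 'n ^ 'm \<Rightarrow> real ^ 'n ^ 'm \<Rightarrow> real" where
  "TU_sigma A B = Max (range (\<lambda>(i, j). A $ i $ j + B $ i $ j))"

definition TU_delta :: "real ^ 'n ^ 'm \<Rightarrow> real ^ 'n ^ 'm \<Rightarrow> real" where
  "TU_delta A B = Val (A - B)"

definition TU_solution :: "real ^ 'n ^ 'm \<Rightarrow> real ^ 'n ^ 'm \<Rightarrow> real \<times> real" where
  "TU_solution A B =
     ((TU_sigma A B + TU_delta A B) / 2, (TU_sigma A B - TU_delta A B) / 2)"

definition no_side_payment_at :: "real ^ 'n ^ 'm \<Rightarrow> real ^ 'n ^ 'm \<Rightarrow> 'm \<Rightarrow> 'n \<Rightarrow> bool" where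
  "no_side_payment_at A B i j \<longleftrightarrow>
     A $ i $ j + B $ i $ j = TU_sigma A B \<and> (A $ i $ j, B $ i $ j) = TU_solution A B"

text \<open>
  The pure strategies Preempt, Status Quo and Deter are the elements 1, 2 and 3 of the
  numeral type \<open>3\<close>.
\<close>

definition U_matrix :: "real \<Rightarrow> real \<Rightarrow> real ^ 3 ^ 3" where
  "U_matrix \<alpha> \<beta> = vector
     [vector [2 - \<alpha>, - (\<alpha> - 1), - \<alpha>],
      vector [1,      0,          - 1],
      vector [\<beta>,      \<beta> - 1,      - (2 - \<beta>)]]"

definition V_matrix :: "real \<Rightarrow> real \<Rightarrow> real ^ 3 ^ 3" where
  "V_matrix \<alpha> \<beta> = vector
     [vector [2 - \<alpha>,       1,   \<beta>],
      vector [- (\<alpha> - 1), 0,   \<beta> - 1],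
      vector [- \<alpha>,        - 1, - (2 - \<beta>)]]"

end

theory Submission
  imports Defs
begin

text \<open>
  A saddle point of a matrix settles its zero-sum game: the row player secures the entry by
  playing its row, because the entry is the least of that row, and the column player holds the
  payoff down to it by playing its column. Both orders of optimisation over mixed strategies are
  therefore squeezed to the entry (\<open>saddle_point_imp_game_value\<close>), and the two pure strategies are
  optimal.

  For the game at hand,
  \<open>U - V = ((0, -\<alpha>, -\<alpha> - \<beta>), (\<alpha>, 0, -\<beta>), (\<alpha> + \<beta>, \<beta>, 0))\<close>
  has a saddle point in its lower right corner because \<open>\<alpha>\<close> and \<open>\<beta>\<close> are positive. The entries of
  \<open>U + V\<close> other than \<open>2 (2 - \<alpha>)\<close> are \<open>2 - \<alpha>\<close>, \<open>\<beta> - \<alpha>\<close> and numbers that are at most \<open>0\<close>; the only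
  serious competitor is \<open>\<beta> - \<alpha>\<close>, and \<open>\<beta> - \<alpha> \<le> 2 (2 - \<alpha>)\<close> amounts to \<open>\<alpha> + \<beta> \<le> 4\<close>.
  The last claim follows since a positive change of the unit of payoff preserves saddle points and
  scales \<open>\<sigma>\<close>.
\<close>

lemma bounded_mixed_strategies: "bounded (mixed_strategies :: (real ^ 'n) set)"
proof (rule boundedI)
  fix p :: "real ^ 'n"
  assume "p \<in> mixed_strategies"
  then have "(\<Sum>i\<in>UNIV. \<bar>p $ i\<bar>) = 1"
    by (simp add: mixed_strategies_def)
  then show "norm p \<le> 1"
    using norm_le_l1_cart[of p] by simp
qed

text \<open>
  Suprema and infima of reals carry information only over bounded sets; the next two lemmas
  supply that boundedness for the inner optimisations.
\<close>

lemma bdd_below_expected_payoff: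
  "bdd_below ((\<lambda>q. expected_payoff M p q) ` mixed_strategies)"
proof -
  have "bounded_linear (\<lambda>q. expected_payoff M p q)"
    unfolding expected_payoff_def
    by (intro bounded_linear_inner_right_comp matrix_vector_mul_bounded_linear)
  then show ?thesis
    by (intro bounded_imp_bdd_below bounded_linear_image bounded_mixed_strategies)
qed

lemma bdd_above_expected_payoff:
  "bdd_above ((\<lambda>p. expected_payoff M p q) ` mixed_strategies)"
  unfolding expected_payoff_def
  by (intro bounded_imp_bdd_above bounded_linear_image bounded_mixed_strategies
      bounded_linear_inner_left)

text \<open>
  The reply \<open>q0\<close> keeps the inner infimum of every \<open>p\<close> at or below \<open>v\<close>, and \<open>p0\<close> attains \<open>v\<close>, so the
  maximin is \<open>v\<close>; exchanging the players gives the same for the minimax.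
\<close>

lemma guarantees_imp_game_value:
  assumes p0: "p0 \<in> mixed_strategies"
    and lower: "\<And>q. q \<in> mixed_strategies \<Longrightarrow> v \<le> expected_payoff M p0 q"
    and q0: "q0 \<in> mixed_strategies"
    and upper: "\<And>p. p \<in> mixed_strategies \<Longrightarrow> expected_payoff M p q0 \<le> v"
  shows "has_game_value M v"
proof -
  let ?I = "\<lambda>p. INF q\<in>mixed_strategies. expected_payoff M p q"
  let ?S = "\<lambda>q. SUP p\<in>mixed_strategies. expected_payoff M p q"
  have I: "?I p \<le> v" if "p \<in> mixed_strategies" for p
    using cINF_lower[OF bdd_below_expected_payoff q0] upper[OF that] by (rule order_trans)
  have S: "v \<le> ?S q" if "q \<in> mixed_strategies" for q
    using lower[OF that] cSUP_upper[OF p0 bdd_above_expected_payoff] by (rule order_trans)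
  have "v \<le> ?I p0"
    using q0 lower by (intro cINF_greatest) auto
  moreover have "?I p0 \<le> maxmin_value M"
    unfolding maxmin_value_def using p0 I by (intro cSUP_upper bdd_aboveI2) auto
  moreover have "maxmin_value M \<le> v"
    unfolding maxmin_value_def using p0 I by (intro cSUP_least) auto
  moreover have "?S q0 \<le> v"
    using p0 upper by (intro cSUP_least) auto
  moreover have "minmax_value M \<le> ?S q0"
    unfolding minmax_value_def using q0 S by (intro cINF_lower bdd_belowI2) auto
  moreover have "v \<le> minmax_value M"
    unfolding minmax_value_def using q0 S by (intro cINF_greatest) auto
  ultimately show ?thesis
    unfolding has_game_value_def by linarith
qed

lemma Val_eqI: "has_game_value M v \<Longrightarrow> Val M = v"
  unfolding Val_def by (rule the_equality) (auto simp: has_game_value_def)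

lemma axis_in_mixed_strategies: "axis i 1 \<in> mixed_strategies"
  by (simp add: mixed_strategies_def axis_def)

lemma saddle_point_row_guarantee:
  assumes "saddle_point M i j" and q: "q \<in> mixed_strategies"
  shows "M $ i $ j \<le> expected_payoff M (axis i 1) q"
proof -
  have "M $ i $ j = (\<Sum>k\<in>UNIV. M $ i $ j * q $ k)"
    using q by (simp add: mixed_strategies_def flip: sum_distrib_left)
  also have "\<dots> \<le> (\<Sum>k\<in>UNIV. M $ i $ k * q $ k)"
    using assms by (intro sum_mono mult_right_mono) (auto simp: saddle_point_def mixed_strategies_def)
  also have "\<dots> = expected_payoff M (axis i 1) q"
    by (simp add: expected_payoff_def inner_axis' matrix_vector_mult_def)
  finally show ?thesis .
qed

lemma saddle_point_column_guarantee:
  assumes "saddle_point M i j" and p: "p \<in> mixed_strategies"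
  shows "expected_payoff M p (axis j 1) \<le> M $ i $ j"
proof -
  have "expected_payoff M p (axis j 1) = (\<Sum>k\<in>UNIV. p $ k * M $ k $ j)"
    by (simp add: expected_payoff_def matrix_vector_mult_basis column_def inner_vec_def)
  also have "\<dots> \<le> (\<Sum>k\<in>UNIV. p $ k * M $ i $ j)"
    using assms by (intro sum_mono mult_left_mono) (auto simp: saddle_point_def mixed_strategies_def)
  also have "\<dots> = M $ i $ j"
    using p by (simp add: mixed_strategies_def flip: sum_distrib_right)
  finally show ?thesis .
qed

lemma saddle_point_imp_game_value:
  assumes "saddle_point M i j"
  shows "has_game_value M (M $ i $ j)"
  by (rule guarantees_imp_game_value[OF axis_in_mixed_strategies
        saddle_point_row_guarantee[OF assms] axis_in_mixed_strategies
        saddle_point_column_guarantee[OF assms]])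

lemma saddle_point_imp_TU_delta:
  "saddle_point (A - B) i j \<Longrightarrow> TU_delta A B = (A - B) $ i $ j"
  unfolding TU_delta_def by (intro Val_eqI saddle_point_imp_game_value)

lemma saddle_point_imp_optimal_threats:
  assumes "saddle_point (A - B) i j"
  shows "optimal_threat_strategies A B (axis i 1) (axis j 1)"
  using saddle_point_row_guarantee[OF assms] saddle_point_column_guarantee[OF assms]
    Val_eqI[OF saddle_point_imp_game_value[OF assms]]
  by (simp add: optimal_threat_strategies_def optimal_row_strategy_def
      optimal_column_strategy_def axis_in_mixed_strategies)

lemma expected_payoff_axis: "expected_payoff M (axis i 1) (axis j 1) = M $ i $ j"
  by (simp add: expected_payoff_def inner_axis' matrix_vector_mult_basis column_def)

lemma saddle_point_scaleR:
  "0 \<le> c \<Longrightarrow> saddle_point M i j \<Longrightarrow> saddle_point (c *\<^sub>R M) i j"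
  by (simp add: saddle_point_def mult_left_mono)

lemma TU_sigma_scaleR:
  assumes "0 \<le> c"
  shows "TU_sigma (c *\<^sub>R A) (c *\<^sub>R B) = c * TU_sigma A B"
proof -
  have "mono ((*) c)"
    using assms by (intro monoI mult_left_mono)
  moreover have "range (\<lambda>(i, j). (c *\<^sub>R A) $ i $ j + (c *\<^sub>R B) $ i $ j)
      = (*) c ` range (\<lambda>(i, j). A $ i $ j + B $ i $ j)"
    by (simp add: image_image case_prod_unfold distrib_left)
  ultimately show ?thesis
    unfolding TU_sigma_def by (simp add: mono_Max_commute)
qed

lemma TU_sigma_eqI:
  assumes "\<And>k l. A $ k $ l + B $ k $ l \<le> A $ i $ j + B $ i $ j"
  shows "TU_sigma A B = A $ i $ j + B $ i $ j"
  unfolding TU_sigma_def using assms by (intro Max_eqI) auto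

theorem mainTheorem1:
  fixes \<alpha> \<beta> :: real
  assumes "1 < \<alpha>" "\<alpha> < 2" "1 < \<beta>" "\<beta> < 2"
  defines "U \<equiv> U_matrix \<alpha> \<beta>"
    and "V \<equiv> V_matrix \<alpha> \<beta>"
    and "e3 \<equiv> (vector [0, 0, 1] :: real ^ 3)"
  shows
    "(saddle_point (U - V) 3 3 \<and> (U - V) $ 3 $ 3 = 0
      \<and> has_game_value (U - V) 0 \<and> TU_delta U V = 0
      \<and> optimal_threat_strategies U V e3 e3
      \<and> disagreement_point U V e3 e3 = (- (2 - \<beta>), - (2 - \<beta>)))
   \<and> TU_sigma U V = 2 * (2 - \<alpha>)
   \<and> (TU_solution U V = (2 - \<alpha>, 2 - \<alpha>)
      \<and> TU_solution U V = (U $ 1 $ 1, V $ 1 $ 1)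
      \<and> no_side_payment_at U V 1 1)
   \<and> (\<forall>B c C b :: real. 0 < B \<longrightarrow> c = \<alpha> * B \<longrightarrow> C = B \<longrightarrow> b = \<beta> * B \<longrightarrow>
        TU_solution (B *\<^sub>R U) (B *\<^sub>R V) = (2 * B - c, 2 * B - c))"
proof -
  note entries = U_def V_def U_matrix_def V_matrix_def
  have saddle: "saddle_point (U - V) 3 3"
    using assms(1-4) by (simp add: saddle_point_def entries forall_3)
  have corner: "(U - V) $ 3 $ 3 = 0"
    by (simp add: entries)
  have delta: "TU_delta U V = 0"
    using saddle_point_imp_TU_delta[OF saddle] corner by simp
  have e3: "e3 = axis 3 1"
    by (simp add: e3_def vec_eq_iff forall_3 axis_def)
  have disagreement: "disagreement_point U V e3 e3 = (- (2 - \<beta>), - (2 - \<beta>))"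
    by (simp add: disagreement_point_def e3 expected_payoff_axis entries)
  have "\<forall>k l. U $ k $ l + V $ k $ l \<le> U $ 1 $ 1 + V $ 1 $ 1"
    using assms(1-4) by (simp add: forall_3 entries)
  then have "TU_sigma U V = U $ 1 $ 1 + V $ 1 $ 1"
    by (intro TU_sigma_eqI) blast
  then have sigma: "TU_sigma U V = 2 * (2 - \<alpha>)"
    by (simp add: entries)
  have solution: "TU_solution U V = (2 - \<alpha>, 2 - \<alpha>)"
    by (simp add: TU_solution_def sigma delta)
  have payoff: "U $ 1 $ 1 = 2 - \<alpha>" "V $ 1 $ 1 = 2 - \<alpha>"
    by (simp_all add: entries)
  have no_side: "no_side_payment_at U V 1 1"
    by (simp add: no_side_payment_at_def sigma solution payoff)
  have scaled: "TU_solution (B *\<^sub>R U) (B *\<^sub>R V) = (2 * B - \<alpha> * B, 2 * B - \<alpha> * B)"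
    if "0 < B" for B :: real
  proof -
    have "saddle_point (B *\<^sub>R U - B *\<^sub>R V) 3 3"
      using saddle_point_scaleR[OF _ saddle] that by (simp add: scaleR_diff_right)
    from saddle_point_imp_TU_delta[OF this] have "TU_delta (B *\<^sub>R U) (B *\<^sub>R V) = 0"
      using corner by simp
    then show ?thesis
      using that by (simp add: TU_solution_def TU_sigma_scaleR sigma field_simps)
  qed
  show ?thesis
    using saddle corner saddle_point_imp_game_value[OF saddle] delta
      saddle_point_imp_optimal_threats[OF saddle] disagreement sigma solution payoff no_side scaled
    by (simp add: e3)
qed

end
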